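(* Let $\mu_1,\mu_2,\mu_3\in\mathbb{R}$ be constants and let $\mathsf{B}$ be a positive definite symmetric tensor on a domain $\Omega\subset\mathbb{R}^3$. Suppose there exists a set $\Lambda_0$ which is compactly included in the set $$\Lambda_{\mu_1,\mu_2,\mu_3}=\left\{\lambda>0;\ \mu_1+\mu_2\lambda+\frac{\mu_3}{\lambda}>0\right\}$$ and such that $\lambda_i(\mathsf{B}(\mathbf{x}))\in\Lambda_0$ almost everywhere on $\Omega$, for every $i=1,2,3$. Then $$\operatorname*{ess\,inf}_{\mathbf{x}\in\Omega}\left\{\min_{i=1,2,3}\left(\mu_1+\mu_2\lambda_i(\mathsf{B}(\mathbf{x}))+\frac{\mu_3}{\lambda_i(\mathsf{B}(\mathbf{x}))}\right)\right\}>0,$$ and $\mathsf{B}$ is $\mathcal{A}$-positive.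
   Context: A tensor on $\Omega$ is a (measurable) $3\times3$-matrix-valued function. $\lambda_1(\mathsf{B}(\mathbf{x}))\le\lambda_2(\mathsf{B}(\mathbf{x}))\le\lambda_3(\mathsf{B}(\mathbf{x}))$ are the eigenvalues of the symmetric matrix $\mathsf{B}(\mathbf{x})$. "$\Lambda_0$ compactly included in $\Lambda$" means that the closure of $\Lambda_0$ in $\mathbb{R}$ is compact and contained in $\Lambda$. $\mathcal{A}(\mathsf{B})=\mu_1\mathsf{I}+\mu_2\mathsf{B}+\mu_3\mathsf{B}^{-1}$, with $\mathsf{I}$ the identity matrix. A symmetric tensor $\mathsf{A}$ on $\Omega$ is uniformly positive definite if there exists $\alpha>0$ such that, for a.e. $\mathbf{x}\in\Omega$, $\mathsf{A}(\mathbf{x})\boldsymbol{\xi}\cdot\boldsymbol{\xi}\ge\alpha|\boldsymbol{\xi}|^2$ for all $\boldsymbol{\xi}\in\mathbb{R}^3$. A positive definite symmetric tensor $\mathsf{B}$ is called $\mathcal{A}$-positive when $\mathcal{A}(\mathsf{B})$ is a uniformly positive definite symmetric tensor. *)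

theory Defs
  imports "HOL-Analysis.Analysis" "HOL-Probability.Essential_Supremum"
    "HOL-Computational_Algebra.Polynomial" "HOL-Library.Multiset"
begin

definition charpoly :: "real^'n^'n \<Rightarrow> real poly" where
  "charpoly A = det (mat [:0, 1:] - map_matrix (\<lambda>a. [:a:]) A)"

text \<open>For a symmetric matrix of size \<open>n\<close>, \<open>eigval A 1 \<le> \<dots> \<le> eigval A n\<close> are its eigenvalues, repeated
  according to multiplicity. The value is unspecified if \<open>A\<close> has fewer than \<open>i\<close> real eigenvalues,
  which cannot happen for symmetric \<open>A\<close> and \<open>1 \<le> i \<le> n\<close>.\<close>
definition eigval :: "real^'n^'n \<Rightarrow> nat \<Rightarrow> real" where
  "eigval A i = sorted_list_of_multiset (proots (charpoly A)) ! (i - 1)"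

text \<open>As for \<^const>\<open>esssup\<close>, a non-measurable function gets the value \<open>-\<infinity>\<close> here, so that a positive
  lower bound on \<open>essinf\<close> includes measurability.\<close>
definition essinf :: "'a measure \<Rightarrow> ('a \<Rightarrow> ereal) \<Rightarrow> ereal" where
  "essinf M f = - esssup M (\<lambda>x. - f x)"

text \<open>Tensors are identified when they agree almost everywhere, so all pointwise properties are
  required almost everywhere, with respect to Lebesgue measure on \<open>\<Omega>\<close>.\<close>
definition symmetric_tensor :: "(real^3) set \<Rightarrow> (real^3 \<Rightarrow> real^3^3) \<Rightarrow> bool" where
  "symmetric_tensor \<Omega> A \<longleftrightarrow>
     A \<in> borel_measurable (lebesgue_on \<Omega>) \<and>
     (AE x in lebesgue_on \<Omega>. transpose (A x) = A x)"

definition pos_def_symmetric_tensor :: "(real^3) set \<Rightarrow> (real^3 \<Rightarrow> real^3^3) \<Rightarrow> bool" where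
  "pos_def_symmetric_tensor \<Omega> A \<longleftrightarrow>
     symmetric_tensor \<Omega> A \<and>
     (AE x in lebesgue_on \<Omega>. \<forall>\<xi>. \<xi> \<noteq> 0 \<longrightarrow> (A x *v \<xi>) \<bullet> \<xi> > 0)"

definition unif_pos_def_symmetric_tensor :: "(real^3) set \<Rightarrow> (real^3 \<Rightarrow> real^3^3) \<Rightarrow> bool" where
  "unif_pos_def_symmetric_tensor \<Omega> A \<longleftrightarrow>
     symmetric_tensor \<Omega> A \<and>
     (\<exists>\<alpha>>0. AE x in lebesgue_on \<Omega>. \<forall>\<xi>. (A x *v \<xi>) \<bullet> \<xi> \<ge> \<alpha> * (norm \<xi>)\<^sup>2)"

definition A_of :: "real \<Rightarrow> real \<Rightarrow> real \<Rightarrow> real^3^3 \<Rightarrow> real^3^3" where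
  "A_of \<mu>1 \<mu>2 \<mu>3 B = \<mu>1 *\<^sub>R mat 1 + \<mu>2 *\<^sub>R B + \<mu>3 *\<^sub>R matrix_inv B"

definition A_positive ::
  "real \<Rightarrow> real \<Rightarrow> real \<Rightarrow> (real^3) set \<Rightarrow> (real^3 \<Rightarrow> real^3^3) \<Rightarrow> bool" where
  "A_positive \<mu>1 \<mu>2 \<mu>3 \<Omega> B \<longleftrightarrow>
     pos_def_symmetric_tensor \<Omega> B \<and>
     unif_pos_def_symmetric_tensor \<Omega> (\<lambda>x. A_of \<mu>1 \<mu>2 \<mu>3 (B x))"

definition Lambda_set :: "real \<Rightarrow> real \<Rightarrow> real \<Rightarrow> real set" where
  "Lambda_set \<mu>1 \<mu>2 \<mu>3 = {l. l > 0 \<and> \<mu>1 + \<mu>2 * l + \<mu>3 / l > 0}"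

definition compactly_included :: "real set \<Rightarrow> real set \<Rightarrow> bool" where
  "compactly_included S T \<longleftrightarrow> compact (closure S) \<and> closure S \<subseteq> T"

end

theory Submission
  imports Defs
begin

text \<open>
  Write \<open>g l = \<mu>1 + \<mu>2 * l + \<mu>3 / l\<close>. At a point where \<open>B\<close> is symmetric and positive definite, the spectral
  theorem gives \<open>B = P D P\<^sup>T\<close> with \<open>P\<close> orthogonal and \<open>D\<close> diagonal with positive entries. The function
  \<open>g\<close> then acts on the diagonal, \<open>A_of \<mu>1 \<mu>2 \<mu>3 B = P g(D) P\<^sup>T\<close>, so the least of the numbers
  \<open>g (eigval B i)\<close> is the best constant \<open>c\<close> in \<open>c |\<xi>|\<^sup>2 \<le> A_of \<mu>1 \<mu>2 \<mu>3 B \<xi> \<bullet> \<xi>\<close>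
  (\<open>le_min_iff_A_of_form_bound\<close>).

  This equivalence does two things. First, \<open>g\<close> is continuous and positive on the compact closure of
  \<open>\<Lambda>0\<close>, hence bounded below there by some \<open>\<alpha> > 0\<close>; so \<open>\<alpha>\<close> is almost everywhere a lower bound for the
  minimum, and by the equivalence also for the quadratic form. Second, it gives the measurability
  that a positive essential infimum includes, without any measurability of the ordered
  eigenvalues one by one: the superlevel sets of the minimum are, up to null sets, preimages of closed
  sets of matrices under \<open>A_of \<mu>1 \<mu>2 \<mu>3 \<circ> B\<close>, which is measurable because matrix inversion is a Borel
  map (\<open>borel_measurable_matrix_inv\<close>).

  The function \<open>eigval\<close> is defined from the sorted roots of the characteristic polynomial. The link to
  the diagonal entries is that \<open>charpoly (P D P\<^sup>T)\<close> is the product of the factors \<open>X - d\<^sub>i\<close>, computed with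
  determinants over the polynomial ring (\<open>charpoly_orthogonal_conjugate_diag\<close>).
\<close>

section \<open>Orthogonal diagonalization of symmetric matrices\<close>

text \<open>The eigenvector is a maximizer of \<open>f x \<bullet> x\<close> on the unit sphere of \<open>S\<close>. With \<open>l\<close> the maximum,
  \<open>l (x \<bullet> x) - f x \<bullet> x\<close> is nonnegative on \<open>S\<close> and vanishes at the maximizer \<open>v\<close>, so its first
  variation at \<open>v\<close> vanishes, which says that \<open>f v - l v\<close> is zero.\<close>

lemma self_adjoint_eigenvector_in_invariant_subspace:
  fixes f :: "'a::euclidean_space \<Rightarrow> 'a"
  assumes lin: "linear f" and adj: "\<And>x y. f x \<bullet> y = x \<bullet> f y"
    and S: "subspace S" "\<And>x. x \<in> S \<Longrightarrow> f x \<in> S" and "S \<noteq> {0}"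
  obtains v l where "v \<in> S" "norm v = 1" "f v = l *\<^sub>R v"
proof -
  define K where "K = S \<inter> sphere 0 1"
  have "compact K"
    unfolding K_def by (intro closed_Int_compact closed_subspace S(1) compact_sphere)
  moreover have "K \<noteq> {}"
  proof -
    obtain x where "x \<in> S" "x \<noteq> 0"
      using \<open>S \<noteq> {0}\<close> subspace_0[OF S(1)] by blast
    then have "(1 / norm x) *\<^sub>R x \<in> K"
      by (simp add: K_def subspace_scale[OF S(1)])
    then show ?thesis by blast
  qed
  moreover have "continuous_on K (\<lambda>x. f x \<bullet> x)"
    using lin by (intro continuous_on_inner continuous_on_id linear_continuous_on)
      (simp add: linear_conv_bounded_linear)
  ultimately have "\<exists>v\<in>K. \<forall>x\<in>K. f x \<bullet> x \<le> f v \<bullet> v"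
    by (rule continuous_attains_sup)
  then obtain v where v: "v \<in> K" "\<And>x. x \<in> K \<Longrightarrow> f x \<bullet> x \<le> f v \<bullet> v"
    by blast
  define l where "l = f v \<bullet> v"
  define h where "h x = l * (x \<bullet> x) - f x \<bullet> x" for x
  have vS: "v \<in> S" and nv: "norm v = 1" and vv: "v \<bullet> v = 1"
    using v(1) by (auto simp: K_def norm_eq_1)
  have h_nonneg: "h x \<ge> 0" if "x \<in> S" for x
  proof (cases "x = 0")
    case False
    have "(1 / norm x) *\<^sub>R x \<in> K"
      using that False by (simp add: K_def subspace_scale[OF S(1)])
    from v(2)[OF this] have "(f x \<bullet> x) / (norm x * norm x) \<le> l"
      by (simp add: l_def linear_scale[OF lin])
    then show ?thesis
      using False by (simp add: h_def divide_simps dot_square_norm power2_eq_square)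
  qed (simp add: h_def)
  define w where "w = f v - l *\<^sub>R v"
  have wS: "w \<in> S"
    unfolding w_def by (intro subspace_diff subspace_scale S vS)
  \<comment> \<open>The linear term is the first variation of \<open>h\<close> at its zero \<open>v\<close> in the direction \<open>w\<close>.\<close>
  have expand: "h (v + t *\<^sub>R w) = t\<^sup>2 * h w - 2 * t * (w \<bullet> w)" for t
  proof -
    have "h (v + t *\<^sub>R w) = h v + t\<^sup>2 * h w + 2 * t * (l * (v \<bullet> w) - f v \<bullet> w)"
    proof -
      have "f w \<bullet> v = f v \<bullet> w"
        by (rule trans[OF adj inner_commute])
      then show ?thesis
        by (simp add: h_def linear_add[OF lin] linear_scale[OF lin] inner_add_left inner_add_right
            inner_commute[of w v] distrib_left right_diff_distrib power2_eq_square mult.left_commute[of l])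
    qed
    moreover have "h v = 0"
      by (simp add: h_def l_def vv)
    moreover have "l * (v \<bullet> w) - f v \<bullet> w = - (w \<bullet> w)"
      by (subst (3) w_def) (simp add: inner_diff_left)
    ultimately show ?thesis
      by simp
  qed
  have "w \<bullet> w = 0"
  proof (rule ccontr)
    assume "w \<bullet> w \<noteq> 0"
    then have a: "w \<bullet> w > 0" by (simp add: inner_gt_zero_iff)
    \<comment> \<open>Small enough for the linear term of the expansion to dominate; the summand 1 avoids dividing by 0.\<close>
    define t where "t = (w \<bullet> w) / (h w + 1)"
    have hw: "h w \<ge> 0" using h_nonneg wS by blast
    have t: "t > 0" "t * h w \<le> w \<bullet> w"
      using a hw by (auto simp: t_def field_simps)
    have "0 \<le> t\<^sup>2 * h w - 2 * t * (w \<bullet> w)"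
      using h_nonneg[of "v + t *\<^sub>R w"] expand[of t] by (simp add: subspace_add subspace_scale S vS wS)
    also have "\<dots> = t * (t * h w - 2 * (w \<bullet> w))"
      by (simp add: algebra_simps power2_eq_square)
    also have "\<dots> < 0"
      using t a by (intro mult_pos_neg) linarith+
    finally show False by simp
  qed
  then have "f v = l *\<^sub>R v"
    by (simp add: w_def)
  with that vS nv show thesis by blast
qed

text \<open>An orthonormal family of fewer than \<open>DIM('a)\<close> eigenvectors can be extended, because its orthogonal
  complement is nonzero and, by self-adjointness, invariant.\<close>
lemma self_adjoint_orthonormal_eigenvectors:
  fixes f :: "'a::euclidean_space \<Rightarrow> 'a"
  assumes lin: "linear f" and adj: "\<And>x y. f x \<bullet> y = x \<bullet> f y"
    and "k \<le> DIM('a)"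
  shows "\<exists>E. finite E \<and> card E = k \<and> pairwise orthogonal E \<and>
           (\<forall>v\<in>E. norm v = 1 \<and> (\<exists>l. f v = l *\<^sub>R v))"
  using \<open>k \<le> DIM('a)\<close>
proof (induction k)
  case 0
  then show ?case by (intro exI[of _ "{}"]) auto
next
  case (Suc k)
  then obtain E where E: "finite E" "card E = k" "pairwise orthogonal E"
      "\<forall>v\<in>E. norm v = 1 \<and> (\<exists>l. f v = l *\<^sub>R v)"
    by auto
  define S where "S = {y. \<forall>x\<in>E. orthogonal x y}"
  have "dim E < DIM('a)"
    using dim_le_card'[OF E(1)] E(2) Suc.prems by linarith
  then obtain x where "x \<noteq> 0" "\<And>y. y \<in> span E \<Longrightarrow> orthogonal x y"
    using orthogonal_to_subspace_exists by blast
  then have "x \<in> S" "x \<noteq> 0"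
    by (auto simp: S_def orthogonal_commute span_base)
  moreover have "f y \<in> S" if "y \<in> S" for y
    unfolding S_def orthogonal_def
  proof (intro CollectI ballI)
    fix v assume "v \<in> E"
    then obtain l where "f v = l *\<^sub>R v"
      using E(4) by blast
    then have "v \<bullet> f y = l * (v \<bullet> y)"
      by (simp flip: adj)
    then show "v \<bullet> f y = 0"
      using that \<open>v \<in> E\<close> by (simp add: S_def orthogonal_def)
  qed
  moreover have "subspace S"
    unfolding S_def by (rule subspace_orthogonal_to_vectors)
  ultimately obtain v l where v: "v \<in> S" "norm v = 1" "f v = l *\<^sub>R v"
    using self_adjoint_eigenvector_in_invariant_subspace[OF lin adj, of S] by blast
  have "v \<notin> E"
    using v(1,2) by (auto simp: S_def orthogonal_def norm_eq_1)
  moreover have "pairwise orthogonal (insert v E)"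
    using E(3) v(1) by (auto simp: pairwise_insert S_def orthogonal_commute)
  ultimately show ?case
    using E v by (intro exI[of _ "insert v E"]) auto
qed

definition diag_matrix :: "('n \<Rightarrow> 'a::zero) \<Rightarrow> 'a^'n^'n" where
  "diag_matrix d = (\<chi> i j. if i = j then d i else 0)"

theorem symmetric_matrix_orthogonally_diagonalizable:
  fixes A :: "real^'n^'n"
  assumes "transpose A = A"
  obtains P d where "orthogonal_matrix P" "A = P ** diag_matrix d ** transpose P"
proof -
  have adj: "(A *v x) \<bullet> y = x \<bullet> (A *v y)" for x y
    by (metis assms dot_lmul_matrix vector_transpose_matrix)
  obtain E where E: "finite E" "card E = CARD('n)" "pairwise orthogonal E"
      "\<forall>v\<in>E. norm v = 1 \<and> (\<exists>l. A *v v = l *\<^sub>R v)"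
    using self_adjoint_orthonormal_eigenvectors[of "(*v) A" "DIM(real^'n)"] adj
    by auto
  obtain b where b: "bij_betw b (UNIV::'n set) E"
    using E(1,2) by (metis finite_class.finite_UNIV finite_same_card_bij)
  have bE: "b i \<in> E" for i
    using b by (auto simp: bij_betw_def)
  have "\<forall>i. \<exists>l. A *v b i = l *\<^sub>R b i"
    using E(4) bE by blast
  then obtain d where d: "A *v b i = d i *\<^sub>R b i" for i
    unfolding choice_iff by blast
  define P where "P = (\<chi> i j. b j $ i)"
  have P: "orthogonal_matrix P"
    unfolding orthogonal_matrix_orthonormal_columns
  proof (intro conjI allI impI)
    show "norm (column i P) = 1" for i
      using E(4) bE by (simp add: P_def column_def)
    show "orthogonal (column i P) (column j P)" if "i \<noteq> j" for i j
    proof -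
      have "b i \<noteq> b j"
        using b that by (auto simp: bij_betw_def inj_on_def)
      then show ?thesis
        using pairwiseD[OF E(3) bE bE] by (simp add: P_def column_def)
    qed
  qed
  have "A ** P = P ** diag_matrix d"
    using d by (simp add: P_def diag_matrix_def vec_eq_iff matrix_matrix_mult_def
        matrix_vector_mult_def if_distrib mult.commute cong: if_cong)
  then have "A ** (P ** transpose P) = P ** diag_matrix d ** transpose P"
    by (simp add: matrix_mul_assoc)
  then have "A = P ** diag_matrix d ** transpose P"
    using P by (simp add: orthogonal_matrix_def)
  with P that show thesis by blast
qed

section \<open>Eigenvalues from the characteristic polynomial\<close>

lemma map_matrix_const_poly_mult:
  fixes A B :: "real^'n^'n"
  shows "map_matrix (\<lambda>a. [:a:]) (A ** B) = map_matrix (\<lambda>a. [:a:]) A ** map_matrix (\<lambda>a. [:a:]) B"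
proof -
  have add: "[:a + b:] = [:a:] + [:b:]" for a b :: real
    by simp
  have *: "[:\<Sum>k\<in>K. g k:] = (\<Sum>k\<in>K. [:g k:])" for K :: "'n set" and g :: "'n \<Rightarrow> real"
    by (induction K rule: infinite_finite_induct) (auto simp: add simp del: add_pCons)
  show ?thesis
    by (simp add: vec_eq_iff matrix_matrix_mult_def * mult_ac)
qed

lemma matrix_diff_distribs:
  fixes A B C :: "'a::ring_1^'n^'n"
  shows "A ** (B - C) = A ** B - A ** C" "(A - B) ** C = A ** C - B ** C"
  by (simp_all add: vec_eq_iff matrix_matrix_mult_def algebra_simps sum_subtractf)

lemma matrix_add_rdistrib:
  fixes A B C :: "'a::semiring_1^'n^'n"
  shows "(A + B) ** C = A ** C + B ** C"
  by (simp add: vec_eq_iff matrix_matrix_mult_def distrib_right sum.distrib)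

text \<open>Similar matrices have the same characteristic polynomial: \<open>P\<close>, read as a matrix of constant
  polynomials, is still orthogonal, and it commutes with the scalar matrix \<open>X\<close>.\<close>
lemma charpoly_orthogonal_conjugate_diag:
  fixes P :: "real^'n^'n"
  assumes "orthogonal_matrix P"
  shows "charpoly (P ** diag_matrix d ** transpose P) = (\<Prod>i\<in>UNIV. [:- d i, 1:])"
proof -
  let ?M = "map_matrix (\<lambda>a::real. [:a:]) :: real^'n^'n \<Rightarrow> real poly^'n^'n"
  let ?X = "mat [:0, 1:] :: real poly^'n^'n"
  have "?M P ** ?M (transpose P) = ?M (mat 1)"
    using assms by (simp add: orthogonal_matrix_def flip: map_matrix_const_poly_mult)
  also have "\<dots> = mat 1"
    by (simp add: vec_eq_iff mat_def one_poly_eq_simps)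
  finally have M: "?M P ** ?M (transpose P) = mat 1" .
  have comm: "?X ** Q = Q ** ?X" for Q :: "real poly^'n^'n"
    by (simp add: vec_eq_iff matrix_matrix_mult_def mat_def if_distrib if_distribR cong: if_cong)
  have "?X = ?M P ** ?X ** ?M (transpose P)"
    by (metis M comm matrix_mul_assoc matrix_mul_rid)
  then have "?X - ?M (P ** diag_matrix d ** transpose P)
      = ?M P ** (?X - ?M (diag_matrix d)) ** ?M (transpose P)"
    by (simp add: map_matrix_const_poly_mult matrix_diff_distribs)
  then have "charpoly (P ** diag_matrix d ** transpose P)
      = det (?M P ** ?M (transpose P)) * det (?X - ?M (diag_matrix d))"
    by (simp add: charpoly_def det_mul mult_ac)
  also have "\<dots> = det (?X - ?M (diag_matrix d))"
    by (simp add: M)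
  also have "\<dots> = (\<Prod>i\<in>UNIV. [:- d i, 1:])"
    by (subst det_diagonal) (auto simp: mat_def diag_matrix_def)
  finally show ?thesis .
qed

lemma eigval_image_orthogonal_conjugate_diag:
  fixes P :: "real^'n^'n"
  assumes "orthogonal_matrix P"
  shows "eigval (P ** diag_matrix d ** transpose P) ` {1..CARD('n)} = range d"
proof -
  let ?xs = "sorted_list_of_multiset (image_mset d (mset_set UNIV))"
  have "proots (charpoly (P ** diag_matrix d ** transpose P)) = (\<Sum>i\<in>UNIV. {#d i#})"
    by (simp add: charpoly_orthogonal_conjugate_diag[OF assms] proots_prod)
  also have "\<dots> = image_mset d (mset_set UNIV)"
    by (simp add: sum_unfold_sum_mset)
  finally have "eigval (P ** diag_matrix d ** transpose P) i = ?xs ! (i - 1)" for i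
    by (simp add: eigval_def)
  then have "eigval (P ** diag_matrix d ** transpose P) ` {1..CARD('n)}
      = (\<lambda>i. ?xs ! (i - 1)) ` Suc ` {..<CARD('n)}"
    by (simp add: image_Suc_lessThan)
  also have "\<dots> = (!) ?xs ` {..<length ?xs}"
    by (simp add: image_image flip: size_mset)
  also have "\<dots> = set ?xs"
    by (auto simp: set_conv_nth)
  finally show ?thesis
    by simp
qed


section \<open>Quadratic forms in an orthonormal eigenbasis\<close>

lemma quadratic_form_orthogonal_conjugate_diag:
  fixes P :: "real^'n^'n"
  shows "((P ** diag_matrix d ** transpose P) *v x) \<bullet> x
      = (\<Sum>i\<in>UNIV. d i * ((x v* P) $ i)\<^sup>2)"
proof -
  have "((P ** diag_matrix d ** transpose P) *v x) \<bullet> x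
      = (diag_matrix d *v (x v* P)) \<bullet> (x v* P)"
    by (metis dot_lmul_matrix matrix_vector_mul_assoc transpose_matrix_vector inner_commute)
  also have "\<dots> = (\<Sum>i\<in>UNIV. d i * ((x v* P) $ i)\<^sup>2)"
    by (simp add: inner_vec_def diag_matrix_def matrix_vector_mult_def[of "vec_lambda _"]
        if_distrib if_distribR power2_eq_square mult.assoc cong: if_cong)
  finally show ?thesis .
qed

lemma orthogonal_matrix_vector_mult:
  fixes P :: "real^'n^'n"
  assumes "orthogonal_matrix P"
  shows "(P *v x) v* P = x" "norm (x v* P) = norm x"
proof -
  show "(P *v x) v* P = x"
    using assms
    by (simp add: orthogonal_matrix_def matrix_vector_mul_assoc flip: transpose_matrix_vector
        del: transpose_matrix_vector)
  have "orthogonal_transformation ((*v) (transpose P))"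
    using assms by (simp add: orthogonal_transformation_matrix del: transpose_matrix_vector)
  then show "norm (x v* P) = norm x"
    by (metis orthogonal_transformation_norm transpose_matrix_vector)
qed

text \<open>The vector \<open>P *v axis i 1\<close> is the \<open>i\<close>-th column of \<open>P\<close>, a unit eigenvector for \<open>d i\<close>; testing the
  form on it gives the converse direction of the lower bound below.\<close>
lemma quadratic_form_at_column:
  fixes P :: "real^'n^'n"
  assumes "orthogonal_matrix P"
  shows "((P ** diag_matrix d ** transpose P) *v (P *v axis i 1)) \<bullet> (P *v axis i 1) = d i"
proof -
  have "(\<Sum>j\<in>UNIV. d j * (axis i 1 $ j)\<^sup>2) = (\<Sum>j\<in>UNIV. if j = i then d j else 0)"
    by (intro sum.cong) (auto simp: axis_def)
  then show ?thesis
    unfolding quadratic_form_orthogonal_conjugate_diag orthogonal_matrix_vector_mult(1)[OF assms]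
    by simp
qed

lemma quadratic_form_lower_bound_iff:
  fixes P :: "real^'n^'n"
  assumes P: "orthogonal_matrix P"
  shows "(\<forall>x. c * (norm x)\<^sup>2 \<le> ((P ** diag_matrix d ** transpose P) *v x) \<bullet> x) \<longleftrightarrow> (\<forall>i. c \<le> d i)"
proof (intro iffI allI)
  fix i
  assume *: "\<forall>x. c * (norm x)\<^sup>2 \<le> ((P ** diag_matrix d ** transpose P) *v x) \<bullet> x"
  show "c \<le> d i"
  proof -
    have "norm (P *v axis i 1) = 1"
      using orthogonal_matrix_vector_mult[OF P, of "axis i 1"]
        orthogonal_matrix_vector_mult(2)[OF P, of "P *v axis i 1"] by simp
    then show ?thesis
      using *[rule_format, of "P *v axis i 1"] by (simp only: quadratic_form_at_column[OF P]) simp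
  qed
next
  fix x
  assume *: "\<forall>i. c \<le> d i"
  have "c * (norm x)\<^sup>2 = c * (norm (x v* P))\<^sup>2"
    by (simp add: orthogonal_matrix_vector_mult[OF P])
  also have "\<dots> = (\<Sum>i\<in>UNIV. c * ((x v* P) $ i)\<^sup>2)"
    unfolding power2_norm_eq_inner inner_vec_def inner_real_def
    by (simp add: sum_distrib_left power2_eq_square)
  also have "\<dots> \<le> ((P ** diag_matrix d ** transpose P) *v x) \<bullet> x"
    unfolding quadratic_form_orthogonal_conjugate_diag
    using * by (intro sum_mono mult_right_mono) auto
  finally show "c * (norm x)\<^sup>2 \<le> ((P ** diag_matrix d ** transpose P) *v x) \<bullet> x" .
qed

section \<open>The action of the tensor function on eigenvalues\<close>

lemma matrix_inv_eqI:
  fixes A :: "'a::field^'n^'n"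
  assumes "A ** C = mat 1"
  shows "matrix_inv A = C"
  unfolding matrix_inv_def
  by (rule some_equality) (metis assms matrix_left_right_inverse matrix_mul_assoc matrix_mul_lid matrix_mul_rid)+

lemma diag_matrix_mult: "diag_matrix a ** diag_matrix b = diag_matrix (\<lambda>i. a i * b i :: 'a::semiring_1)"
proof -
  have "(if i = k then a i else 0) * (if k = j then b k else 0)
      = (if k = i then if i = j then a i * b i else 0 else 0)" for i j k
    by auto
  then show ?thesis
    by (simp add: diag_matrix_def vec_eq_iff matrix_matrix_mult_def)
qed

lemma A_of_orthogonal_conjugate_diag:
  fixes P :: "real^3^3"
  assumes P: "orthogonal_matrix P" and d: "\<And>i. d i \<noteq> 0"
  shows "A_of \<mu>1 \<mu>2 \<mu>3 (P ** diag_matrix d ** transpose P)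
      = P ** diag_matrix (\<lambda>i. \<mu>1 + \<mu>2 * d i + \<mu>3 / d i) ** transpose P"
proof -
  have one: "mat 1 = P ** diag_matrix (\<lambda>i. 1) ** transpose P"
    using P by (simp add: orthogonal_matrix_def diag_matrix_def flip: mat_def)
  have "(P ** diag_matrix d ** transpose P) ** (P ** diag_matrix (\<lambda>i. 1 / d i) ** transpose P)
      = P ** diag_matrix d ** (transpose P ** P) ** diag_matrix (\<lambda>i. 1 / d i) ** transpose P"
    by (simp add: matrix_mul_assoc)
  also have "\<dots> = P ** (diag_matrix d ** diag_matrix (\<lambda>i. 1 / d i)) ** transpose P"
    using P by (simp add: orthogonal_matrix_def matrix_mul_assoc)
  also have "\<dots> = mat 1"
    using d by (simp add: diag_matrix_mult one)
  finally have inv: "matrix_inv (P ** diag_matrix d ** transpose P)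
      = P ** diag_matrix (\<lambda>i. 1 / d i) ** transpose P"
    by (rule matrix_inv_eqI)
  have "diag_matrix (\<lambda>i. \<mu>1 + \<mu>2 * d i + \<mu>3 / d i)
      = \<mu>1 *\<^sub>R diag_matrix (\<lambda>i. 1) + \<mu>2 *\<^sub>R diag_matrix d + \<mu>3 *\<^sub>R (diag_matrix (\<lambda>i. 1 / d i) :: real^3^3)"
    by (simp add: vec_eq_iff diag_matrix_def)
  then show ?thesis
    unfolding A_of_def inv one
    by (simp add: matrix_add_ldistrib matrix_add_rdistrib matrix_scalar_ac scalar_matrix_assoc)
qed

text \<open>All three summands of \<open>A_of\<close> are diagonal in the eigenbasis of \<open>M\<close>, and positivity of the form
  makes the eigenvalues nonzero, so that the inverse is \<open>P D\<^sup>-\<^sup>1 P\<^sup>T\<close>. Both facts are then read off from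
  the diagonal form.\<close>
lemma
  fixes M :: "real^3^3"
  assumes sym: "transpose M = M" and pos: "\<And>x. x \<noteq> 0 \<Longrightarrow> (M *v x) \<bullet> x > 0"
  shows le_min_iff_A_of_form_bound:
      "c \<le> (MIN i\<in>{1,2,3}. \<mu>1 + \<mu>2 * eigval M i + \<mu>3 / eigval M i)
      \<longleftrightarrow> (\<forall>x. c * (norm x)\<^sup>2 \<le> (A_of \<mu>1 \<mu>2 \<mu>3 M *v x) \<bullet> x)" (is "?thesis1")
    and transpose_A_of: "transpose (A_of \<mu>1 \<mu>2 \<mu>3 M) = A_of \<mu>1 \<mu>2 \<mu>3 M" (is "?thesis2")
proof -
  obtain P d where P: "orthogonal_matrix P" and M: "M = P ** diag_matrix d ** transpose P"
    using symmetric_matrix_orthogonally_diagonalizable[OF sym] by blast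
  define g where "g l = \<mu>1 + \<mu>2 * l + \<mu>3 / l" for l
  have "d i \<noteq> 0" for i
  proof -
    have "P *v axis i 1 \<noteq> 0"
      using orthogonal_matrix_vector_mult(1)[OF P, of "axis i 1"] by force
    from pos[OF this] have "d i > 0"
      by (simp only: M quadratic_form_at_column[OF P])
    then show ?thesis
      by simp
  qed
  then have A: "A_of \<mu>1 \<mu>2 \<mu>3 M = P ** diag_matrix (\<lambda>i. g (d i)) ** transpose P"
    unfolding M g_def by (rule A_of_orthogonal_conjugate_diag[OF P])
  have "{1,2,3} = {1..CARD(3)}"
    by auto
  then have "eigval M ` {1,2,3} = range d"
    using eigval_image_orthogonal_conjugate_diag[OF P, of d] M by simp
  then have "(\<lambda>i. g (eigval M i)) ` {1,2,3} = range (\<lambda>i. g (d i))"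
    by (metis image_image)
  then have "c \<le> (MIN i\<in>{1,2,3}. g (eigval M i)) \<longleftrightarrow> (\<forall>i. c \<le> g (d i))"
    by simp
  then show ?thesis1
    by (simp add: A quadratic_form_lower_bound_iff[OF P] flip: g_def)
  have "transpose (diag_matrix a) = diag_matrix a" for a :: "3 \<Rightarrow> real"
    by (auto simp: vec_eq_iff transpose_def diag_matrix_def)
  then show ?thesis2
    by (simp add: A matrix_transpose_mul matrix_mul_assoc)
qed

section \<open>Measurability\<close>

lemma continuous_on_det:
  fixes f :: "'a::topological_space \<Rightarrow> real^'n^'n"
  assumes "\<And>i j. continuous_on S (\<lambda>x. f x $ i $ j)"
  shows "continuous_on S (\<lambda>x. det (f x))"
  unfolding det_def by (intro continuous_intros assms)

text \<open>On the open set of invertible matrices the inverse is given by Cramer's rule, hence continuous. On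
  the complement, \<open>matrix_inv\<close> is a choice from the empty set of inverses, hence the same
  matrix for all arguments.\<close>
lemma borel_measurable_matrix_inv: "(matrix_inv :: real^'n^'n \<Rightarrow> real^'n^'n) \<in> borel_measurable borel"
proof -
  let ?U = "{A :: real^'n^'n. det A \<noteq> 0}"
  define adj :: "real^'n^'n \<Rightarrow> real^'n^'n" where
    "adj A = (\<chi> k l. det (\<chi> i j. if j = k then axis l 1 $ i else A $ i $ j) / det A)" for A
  have "matrix_inv A = adj A" if "det A \<noteq> 0" for A
  proof (rule matrix_inv_eqI)
    have "A *v column l (adj A) = axis l 1" for l
      by (subst cramer[OF that]) (simp add: adj_def column_def)
    then show "A ** adj A = mat 1"
      by (simp add: vec_eq_iff matrix_matrix_mult_def matrix_vector_mult_def column_def mat_def axis_def)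
  qed
  \<comment> \<open>The matrix \<open>0\<close> serves as a representative of the singular matrices.\<close>
  moreover have "matrix_inv A = matrix_inv 0" if "det A = 0" for A :: "real^'n^'n"
  proof -
    have "\<not> invertible A" "\<not> invertible (0 :: real^'n^'n)"
      using that det_0 by (auto simp: invertible_det_nz mat_0)
    then have "\<not> (A ** A' = mat 1 \<and> A' ** A = mat 1)" "\<not> (0 ** A' = mat 1 \<and> A' ** 0 = mat 1)"
      for A' :: "real^'n^'n"
      unfolding invertible_def by blast+
    then show ?thesis
      by (simp only: matrix_inv_def simp_thms)
  qed
  ultimately have "matrix_inv = (\<lambda>A. if A \<in> ?U then adj A else matrix_inv 0)"
    by auto
  also have "\<dots> \<in> borel_measurable borel"
  proof (rule borel_measurable_continuous_on_if)
    have "open ?U"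
      by (intro open_Collect_neq continuous_on_det continuous_intros)
    then show "?U \<in> sets borel"
      by simp
    show "continuous_on ?U adj"
      unfolding adj_def
    proof (intro continuous_on_vec_lambda continuous_on_divide continuous_on_det)
      show "continuous_on ?U (\<lambda>A. (\<chi> i j. if j = k then axis l 1 $ i else A $ i $ j) $ i' $ j')" for k l i' j'
        by (cases "j' = k") (auto intro!: continuous_intros)
    qed (auto intro!: continuous_intros)
  qed auto
  finally show ?thesis .
qed

text \<open>Completeness allows sets to be replaced by almost everywhere equal ones; it is needed because \<open>eigval\<close>
  has no controlled value at points where the tensor fails to be symmetric.\<close>
lemma complete_measure_lebesgue_on:
  assumes "S \<in> sets lebesgue"
  shows "complete_measure (lebesgue_on S)"
proof
  fix N N' assume "N' \<subseteq> N" "N \<in> null_sets (lebesgue_on S)"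
  then have "N' \<in> null_sets lebesgue" "N' \<subseteq> S"
    using assms by (auto simp: null_sets_restrict_space intro: completion.complete2)
  then have "N' \<in> null_sets (lebesgue_on S)"
    using assms by (auto simp: null_sets_restrict_space)
  then show "N' \<in> sets (lebesgue_on S)"
    by auto
qed

lemma closed_quadratic_form_lower_bound:
  "closed {M :: real^'n^'n. \<forall>x. c * (norm x)\<^sup>2 \<le> (M *v x) \<bullet> x}"
  unfolding matrix_vector_mult_def
  by (intro closed_Collect_all closed_Collect_le continuous_intros)


section \<open>Positivity of the tensor\<close>

theorem proposition5p2:
  fixes \<mu>1 \<mu>2 \<mu>3 :: real
    and \<Omega> :: "(real^3) set"
    and B :: "real^3 \<Rightarrow> real^3^3"
  assumes "open \<Omega>" and "connected \<Omega>" and "\<Omega> \<noteq> {}"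
    and "pos_def_symmetric_tensor \<Omega> B"
    and "\<exists>\<Lambda>0. compactly_included \<Lambda>0 (Lambda_set \<mu>1 \<mu>2 \<mu>3) \<and>
           (\<forall>i\<in>{1,2,3}. AE x in lebesgue_on \<Omega>. eigval (B x) i \<in> \<Lambda>0)"
  shows "essinf (lebesgue_on \<Omega>)
           (\<lambda>x. ereal (MIN i\<in>{1,2,3}.
              \<mu>1 + \<mu>2 * eigval (B x) i + \<mu>3 / eigval (B x) i)) > 0
         \<and> A_positive \<mu>1 \<mu>2 \<mu>3 \<Omega> B"
proof
  let ?M = "lebesgue_on \<Omega>"
  let ?A = "\<lambda>x. A_of \<mu>1 \<mu>2 \<mu>3 (B x)"
  define g where "g l = \<mu>1 + \<mu>2 * l + \<mu>3 / l" for l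
  define m where "m x = (MIN i\<in>{1,2,3}. g (eigval (B x) i))" for x
  have "\<Omega> \<in> sets lebesgue"
    using \<open>open \<Omega>\<close> by auto
  then interpret complete_measure ?M
    by (rule complete_measure_lebesgue_on)
  have B: "B \<in> borel_measurable ?M" "AE x in ?M. transpose (B x) = B x"
      "AE x in ?M. \<forall>\<xi>. \<xi> \<noteq> 0 \<longrightarrow> (B x *v \<xi>) \<bullet> \<xi> > 0"
    using assms(4) by (auto simp: pos_def_symmetric_tensor_def symmetric_tensor_def)
  have good: "AE x in ?M. transpose (?A x) = ?A x \<and>
      (\<forall>c. c \<le> m x \<longleftrightarrow> (\<forall>\<xi>. c * (norm \<xi>)\<^sup>2 \<le> (?A x *v \<xi>) \<bullet> \<xi>))"
    using B(2,3) by eventually_elim (simp only: le_min_iff_A_of_form_bound transpose_A_of m_def g_def simp_thms)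
  have [measurable]: "?A \<in> borel_measurable ?M"
    unfolding A_of_def using B(1) measurable_compose[OF B(1) borel_measurable_matrix_inv]
    by (intro borel_measurable_add borel_measurable_scaleR borel_measurable_const)
  have meas: "m \<in> borel_measurable ?M"
    unfolding borel_measurable_iff_ge
  proof
    fix c
    let ?C = "{M :: real^3^3. \<forall>\<xi>. c * (norm \<xi>)\<^sup>2 \<le> (M *v \<xi>) \<bullet> \<xi>}"
    have C: "?C \<in> sets borel"
      using closed_quadratic_form_lower_bound by (rule borel_closed)
    show "{x \<in> space ?M. c \<le> m x} \<in> sets ?M"
    proof (rule in_sets_AE)
      show "?A -` ?C \<inter> space ?M \<in> sets ?M"
        by (rule measurable_sets[OF _ C]) measurable
      show "AE x in ?M. x \<in> ?A -` ?C \<inter> space ?M \<longleftrightarrow> x \<in> {x \<in> space ?M. c \<le> m x}"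
        using good AE_space by eventually_elim auto
    qed auto
  qed
  obtain L where L: "compactly_included L (Lambda_set \<mu>1 \<mu>2 \<mu>3)"
      "\<forall>i\<in>{1,2,3}. AE x in ?M. eigval (B x) i \<in> L"
    using assms(5) by blast
  have K: "compact (closure L)" "\<And>l. l \<in> closure L \<Longrightarrow> l > 0 \<and> g l > 0"
    using L(1) by (auto simp: compactly_included_def Lambda_set_def g_def)
  have "\<exists>\<alpha>>0. \<forall>l\<in>closure L. \<alpha> \<le> g l"
  proof (cases "closure L = {}")
    case False
    have "continuous_on (closure L) g"
      unfolding g_def using K(2) by (intro continuous_intros) auto
    from continuous_attains_inf[OF K(1) False this] show ?thesis
      using K(2) by blast
  qed (auto intro: exI[of _ 1])
  then obtain \<alpha> where \<alpha>: "\<alpha> > 0" "\<And>l. l \<in> L \<Longrightarrow> \<alpha> \<le> g l"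
    using closure_subset by blast
  have "AE x in ?M. \<forall>i\<in>{1,2,3}. eigval (B x) i \<in> L"
    using L(2) by (simp add: AE_ball_countable)
  then have bound: "AE x in ?M. \<alpha> \<le> m x"
    by eventually_elim (auto simp: m_def intro!: \<alpha>(2))
  have "esssup ?M (\<lambda>x. - ereal (m x)) \<le> - ereal \<alpha>"
    using bound meas by (intro esssup_I) auto
  then have "ereal \<alpha> \<le> essinf ?M (\<lambda>x. ereal (m x))"
    unfolding essinf_def by (metis ereal_minus_le_minus ereal_uminus_uminus)
  with \<alpha>(1) have "0 < essinf ?M (\<lambda>x. ereal (m x))"
    by (simp add: less_le_trans[of 0 "ereal \<alpha>"])
  then show "essinf ?M (\<lambda>x. ereal (MIN i\<in>{1,2,3}.
      \<mu>1 + \<mu>2 * eigval (B x) i + \<mu>3 / eigval (B x) i)) > 0"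
    by (simp only: m_def g_def)
  have "AE x in ?M. \<forall>\<xi>. (?A x *v \<xi>) \<bullet> \<xi> \<ge> \<alpha> * (norm \<xi>)\<^sup>2"
    using good bound by eventually_elim blast
  moreover have "symmetric_tensor \<Omega> ?A"
    unfolding symmetric_tensor_def using good by (auto elim: eventually_mono)
  ultimately show "A_positive \<mu>1 \<mu>2 \<mu>3 \<Omega> B"
    unfolding A_positive_def unif_pos_def_symmetric_tensor_def using assms(4) \<alpha>(1) by blast
qed

end
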